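(* Let $X$ be a uniformly convex Banach space with $\dim(X)\ge 2$, with norm $\|\cdot\|$, and suppose there is $\sigma>0$ such that the modulus of convexity of $X$ satisfies $$\delta(\epsilon)\ge\frac{\sigma}{8}\epsilon^2\quad\text{for all }\epsilon\in[0,2].$$ Then the norm function $f(x)=\|x\|$ is strongly quasiconvex on every nonempty bounded convex set $\Omega\subset X$ (i.e., for each such $\Omega$ there is $\sigma_\Omega>0$ such that $f$ is $\sigma_\Omega$-strongly quasiconvex on $\Omega$). In particular, $f$ is strongly quasiconvex with parameter $\frac{\sigma}{2}$ on the closed unit ball of $X$.
   Context: Spaces are real. For $\tau>0$, a function $f$ is $\tau$-strongly quasiconvex (strongly quasiconvex with parameter $\tau$) on a nonempty convex set $\Omega$ if $f(\lambda x+(1-\lambda)y)\le\max\{f(x),f(y)\}-\frac{\tau}{2}\lambda(1-\lambda)\|x-y\|^2$ for all $x,y\in\Omega$ and $0<\lambda<1$. The modulus of convexity $\delta\colon[0,2]\to\mathbb{R}$ of $X$ is $$\delta(\epsilon)=\inf\left\{1-\left\|\tfrac{x+y}{2}\right\| : \|x\|=\|y\|=1,\ \|x-y\|\ge\epsilon\right\}.$$ $X$ is uniformly convex if $\delta(\epsilon)>0$ for every $\epsilon\in(0,2]$. *)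

theory Defs
  imports "HOL-Analysis.Analysis"
begin

definition strongly_quasiconvex_on ::
    "real \<Rightarrow> 'a::real_normed_vector set \<Rightarrow> ('a \<Rightarrow> real) \<Rightarrow> bool" where
  "strongly_quasiconvex_on \<tau> \<Omega> f \<longleftrightarrow>
     \<tau> > 0 \<and> \<Omega> \<noteq> {} \<and> convex \<Omega> \<and>
     (\<forall>x\<in>\<Omega>. \<forall>y\<in>\<Omega>. \<forall>t. 0 < t \<and> t < 1 \<longrightarrow>
        f (t *\<^sub>R x + (1 - t) *\<^sub>R y)
          \<le> max (f x) (f y) - \<tau> / 2 * t * (1 - t) * (norm (x - y))\<^sup>2)"

text \<open>The space is passed as a type token. The modulus is only meaningful on \<open>[0,2]\<close> and for a
  nontrivial space: there the set below is nonempty (it contains the value for \<open>y = - x\<close>) and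
  bounded below by 0, whereas otherwise \<open>Inf {}\<close> is unspecified.\<close>

definition modulus_of_convexity :: "'a::real_normed_vector itself \<Rightarrow> real \<Rightarrow> real" where
  "modulus_of_convexity (_ :: 'a itself) \<epsilon> =
     Inf {1 - norm ((x + y) /\<^sub>R 2) | x y :: 'a. norm x = 1 \<and> norm y = 1 \<and> norm (x - y) \<ge> \<epsilon>}"

definition uniformly_convex :: "'a::real_normed_vector itself \<Rightarrow> bool" where
  "uniformly_convex (X :: 'a itself) \<longleftrightarrow> (\<forall>\<epsilon>\<in>{0<..2}. modulus_of_convexity X \<epsilon> > 0)"

text \<open>The library's \<open>dim UNIV\<close> is 0 for infinite-dimensional spaces, so a lower bound on the
  dimension is expressed by an independent set of two elements.\<close>

definition dim_at_least_two :: "'a::real_vector itself \<Rightarrow> bool" where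
  "dim_at_least_two (_ :: 'a itself) \<longleftrightarrow> (\<exists>B :: 'a set. independent B \<and> card B = 2)"

end

theory Submission
  imports Defs
begin

text \<open>On the unit sphere the modulus bounds the norm of midpoints; comparing a point of a segment
  with the midpoint and the nearer endpoint extends this to all convex combinations, losing only a
  factor of 2 in the constant. A point \<open>y = s u\<close> inside the ball is reduced to \<open>u\<close> on the sphere
  through \<open>t x + (1 - t) y = s (t x + (1 - t) u) + (1 - s) t x\<close> and the estimate
  \<open>\<parallel>x - y\<parallel>\<^sup>2 \<le> s \<parallel>x - u\<parallel>\<^sup>2 + 1 - s\<close>. Balls of other radii follow by scaling.\<close>

lemma modulus_of_convexity_le:
  fixes x y :: "'a::real_normed_vector"
  assumes "norm x = 1" "norm y = 1" "norm (x - y) \<ge> \<epsilon>"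
  shows "modulus_of_convexity TYPE('a) \<epsilon> \<le> 1 - norm ((x + y) /\<^sub>R 2)"
  unfolding modulus_of_convexity_def
proof (rule cInf_lower)
  show "bdd_below {1 - norm ((x + y) /\<^sub>R 2) | x y :: 'a.
      norm x = 1 \<and> norm y = 1 \<and> norm (x - y) \<ge> \<epsilon>}"
  proof (rule bdd_belowI)
    fix z assume "z \<in> {1 - norm ((x + y) /\<^sub>R 2) | x y :: 'a.
      norm x = 1 \<and> norm y = 1 \<and> norm (x - y) \<ge> \<epsilon>}"
    then obtain x y :: 'a where z: "z = 1 - norm ((x + y) /\<^sub>R 2)" and "norm x = 1" "norm y = 1"
      by blast
    then show "0 \<le> z"
      using norm_triangle_ineq[of x y] by simp
  qed
qed (use assms in blast)

text \<open>Taking \<open>\<epsilon> = norm (x - y)\<close> turns the infimum into a bound for the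
  given pair; the triangle inequality keeps this value in \<open>{0..2}\<close>.\<close>

lemma norm_midpoint_le_of_modulus:
  fixes x y :: "'a::real_normed_vector"
  assumes modulus: "\<forall>\<epsilon>\<in>{0..2}. modulus_of_convexity TYPE('a) \<epsilon> \<ge> c * \<epsilon>\<^sup>2"
    and "norm x = 1" "norm y = 1"
  shows "norm ((x + y) /\<^sub>R 2) \<le> 1 - c * (norm (x - y))\<^sup>2"
proof -
  have "norm (x - y) \<in> {0..2}"
    using assms norm_triangle_ineq4[of x y] by simp
  with modulus have "c * (norm (x - y))\<^sup>2 \<le> modulus_of_convexity TYPE('a) (norm (x - y))"
    by blast
  also have "\<dots> \<le> 1 - norm ((x + y) /\<^sub>R 2)"
    using assms(2,3) by (intro modulus_of_convexity_le) auto
  finally show ?thesis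
    by linarith
qed

context
  fixes c :: real
  assumes c_nonneg: "c \<ge> 0"
    and midpoint: "\<And>x y :: 'a::real_normed_vector. \<lbrakk>norm x = 1; norm y = 1\<rbrakk> \<Longrightarrow>
      norm ((x + y) /\<^sub>R 2) \<le> 1 - c * (norm (x - y))\<^sup>2"
begin

text \<open>For \<open>t \<le> 1 / 2\<close> the point lies between \<open>y\<close> and the
  midpoint, with weight \<open>2 * t\<close> on the midpoint, so convexity of the norm passes on
  that share of the midpoint gain.\<close>

lemma norm_convex_combination_sphere_half:
  fixes x y :: 'a
  assumes "norm x = 1" "norm y = 1" "0 \<le> t" "t \<le> 1 / 2"
  shows "norm (t *\<^sub>R x + (1 - t) *\<^sub>R y) \<le> 1 - 2 * c * t * (1 - t) * (norm (x - y))\<^sup>2"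
proof -
  have "t *\<^sub>R x + (1 - t) *\<^sub>R y = (2 * t) *\<^sub>R ((x + y) /\<^sub>R 2) + (1 - 2 * t) *\<^sub>R y"
    by (simp add: algebra_simps) (metis mult_2_right scaleR_left_distrib)
  also have "norm \<dots> \<le> 2 * t * norm ((x + y) /\<^sub>R 2) + (1 - 2 * t) * norm y"
    using assms by (intro norm_triangle_mono) auto
  also have "\<dots> \<le> 2 * t * (1 - c * (norm (x - y))\<^sup>2) + (1 - 2 * t)"
    using assms mult_left_mono[OF midpoint[OF assms(1,2)], of "2 * t"] by simp
  \<comment> \<open>Writing \<open>t\<close> as \<open>t * (1 - t) + t\<^sup>2\<close> and dropping
    the square makes the bound symmetric in \<open>t\<close> and \<open>1 - t\<close>.\<close>
  also have "\<dots> = 1 - 2 * c * t * (1 - t) * (norm (x - y))\<^sup>2 - 2 * c * t\<^sup>2 * (norm (x - y))\<^sup>2"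
    by (simp add: algebra_simps power2_eq_square)
  also have "\<dots> \<le> 1 - 2 * c * t * (1 - t) * (norm (x - y))\<^sup>2"
    using c_nonneg by simp
  finally show ?thesis .
qed

lemma norm_convex_combination_sphere:
  fixes x y :: 'a
  assumes "norm x = 1" "norm y = 1" "0 \<le> t" "t \<le> 1"
  shows "norm (t *\<^sub>R x + (1 - t) *\<^sub>R y) \<le> 1 - 2 * c * t * (1 - t) * (norm (x - y))\<^sup>2"
proof (cases "t \<le> 1 / 2")
  case True
  then show ?thesis
    using assms norm_convex_combination_sphere_half by blast
next
  case False
  then show ?thesis
    using assms norm_convex_combination_sphere_half[of y x "1 - t"]
    by (simp add: add.commute norm_minus_commute mult_ac)
qed

lemma norm_convex_combination_ball:
  fixes x y :: 'a
  assumes x: "norm x = 1" and y: "norm y \<le> 1" and t: "0 \<le> t" "t \<le> 1"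
  shows "norm (t *\<^sub>R x + (1 - t) *\<^sub>R y) \<le> 1 - 2 * c * t * (1 - t) * (norm (x - y))\<^sup>2"
proof -
  define s where "s = norm y"
  \<comment> \<open>For \<open>y = 0\<close> any unit vector would serve as direction;
    \<open>x\<close> is one at hand.\<close>
  define u where "u = (if y = 0 then x else y /\<^sub>R s)"
  have s: "0 \<le> s" "s \<le> 1" and u: "norm u = 1" "y = s *\<^sub>R u"
    using x y by (auto simp: s_def u_def)
  define e where "e = norm (x - u)"
  \<comment> \<open>The antipodal pair has midpoint 0 and distance 2, which forces
    \<open>4 * c \<le> 1\<close>; half of this suffices below.\<close>
  have "norm (x - (- x)) = 2"
    using x by (simp flip: scaleR_2)
  then have c: "2 * c \<le> 1"
    using midpoint[of x "- x"] x by simp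
  have "x - y = s *\<^sub>R (x - u) + (1 - s) *\<^sub>R x"
    by (simp add: u algebra_simps)
  also have "norm \<dots> \<le> s * e + (1 - s)"
    using s x by (intro norm_triangle_mono) (auto simp: e_def)
  finally have "(norm (x - y))\<^sup>2 \<le> (s * e + (1 - s))\<^sup>2"
    by (intro power_mono) auto
  \<comment> \<open>Convexity of the square at \<open>e\<close> and 1 with weights \<open>s\<close>
    and \<open>1 - s\<close>, with its exact defect.\<close>
  also have "\<dots> = s * e\<^sup>2 + (1 - s) - s * (1 - s) * (e - 1)\<^sup>2"
    by (simp add: algebra_simps power2_eq_square)
  also have "\<dots> \<le> s * e\<^sup>2 + (1 - s)"
    using s by simp
  finally have "2 * c * t * (1 - t) * (norm (x - y))\<^sup>2 \<le> 2 * c * t * (1 - t) * (s * e\<^sup>2 + (1 - s))"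
    using c_nonneg t by (intro mult_left_mono) auto
  \<comment> \<open>Since \<open>s + (1 - s) * t = 1 - (1 - t) * (1 - s)\<close>, the slack
    \<open>(1 - t) * (1 - s)\<close> in the next estimate pays for the \<open>1 - s\<close> in the
    bound on the squared distance.\<close>
  moreover have "(2 * c * t) * ((1 - t) * (1 - s)) \<le> 1 * ((1 - t) * (1 - s))"
    using mult_mono[OF c t(2)] c_nonneg t s by (intro mult_right_mono) auto
  moreover have "norm (t *\<^sub>R x + (1 - t) *\<^sub>R y)
      \<le> s * (1 - 2 * c * t * (1 - t) * e\<^sup>2) + (1 - s) * t"
  proof -
    have "t *\<^sub>R x + (1 - t) *\<^sub>R y = s *\<^sub>R (t *\<^sub>R x + (1 - t) *\<^sub>R u) + ((1 - s) * t) *\<^sub>R x"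
      by (simp add: u algebra_simps)
    also have "norm \<dots> \<le> s * norm (t *\<^sub>R x + (1 - t) *\<^sub>R u) + (1 - s) * t"
      using s x t by (intro norm_triangle_mono) auto
    also have "\<dots> \<le> s * (1 - 2 * c * t * (1 - t) * e\<^sup>2) + (1 - s) * t"
      using norm_convex_combination_sphere[OF x u(1) t] s
      by (simp add: mult_left_mono e_def)
    finally show ?thesis .
  qed
  ultimately show ?thesis
    by (simp add: algebra_simps)
qed

text \<open>Dividing by the larger norm \<open>r\<close> puts \<open>x\<close> on the sphere and
  \<open>y\<close> in the ball. Scaling back leaves a factor \<open>1 / r\<close>, which
  \<open>1 / M\<close> bounds from below uniformly.\<close>

lemma norm_convex_combination_le:
  fixes x y :: 'a
  assumes yx: "norm y \<le> norm x" and M: "norm x \<le> M" and t: "0 \<le> t" "t \<le> 1"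
  shows "norm (t *\<^sub>R x + (1 - t) *\<^sub>R y) \<le> norm x - 2 * c / M * t * (1 - t) * (norm (x - y))\<^sup>2"
proof (cases "x = 0")
  case True
  then show ?thesis using yx by simp
next
  case False
  define r where "r = norm x"
  have r: "r > 0" "r \<le> M"
    using False M by (auto simp: r_def)
  have "norm (t *\<^sub>R x + (1 - t) *\<^sub>R y) = r * norm (t *\<^sub>R (x /\<^sub>R r) + (1 - t) *\<^sub>R (y /\<^sub>R r))"
  proof -
    have cancel: "r * (a * inverse r) = a" for a
      using r by simp
    have "t *\<^sub>R x + (1 - t) *\<^sub>R y = r *\<^sub>R (t *\<^sub>R (x /\<^sub>R r) + (1 - t) *\<^sub>R (y /\<^sub>R r))"
      by (simp only: scaleR_add_right scaleR_scaleR cancel)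
    then show ?thesis
      using r by (metis norm_scaleR abs_of_pos)
  qed
  also have "\<dots> \<le> r * (1 - 2 * c * t * (1 - t) * (norm (x /\<^sub>R r - y /\<^sub>R r))\<^sup>2)"
    using r yx t by (intro mult_left_mono norm_convex_combination_ball) (auto simp: r_def field_simps)
  also have "norm (x /\<^sub>R r - y /\<^sub>R r) = norm (x - y) / r"
    using r by (simp flip: scaleR_diff_right add: divide_inverse)
  also have "r * (1 - 2 * c * t * (1 - t) * (norm (x - y) / r)\<^sup>2)
      = r - 2 * c * t * (1 - t) * (norm (x - y))\<^sup>2 / r"
    using r by (simp add: field_simps power2_eq_square)
  also have "\<dots> \<le> r - 2 * c * t * (1 - t) * (norm (x - y))\<^sup>2 / M"
    using r c_nonneg t by (intro diff_left_mono divide_left_mono) auto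
  finally show ?thesis
    by (simp add: r_def)
qed

text \<open>The factor 4 offsets the halving of \<open>\<tau>\<close> in the definition.\<close>

lemma strongly_quasiconvex_on_norm:
  fixes \<Omega> :: "'a set"
  assumes "c > 0" "M > 0" "\<Omega> \<noteq> {}" "convex \<Omega>" and M: "\<And>x. x \<in> \<Omega> \<Longrightarrow> norm x \<le> M"
  shows "strongly_quasiconvex_on (4 * c / M) \<Omega> norm"
  unfolding strongly_quasiconvex_on_def
proof (intro conjI ballI allI impI)
  fix x y t assume xy: "x \<in> \<Omega>" "y \<in> \<Omega>" and t: "0 < t \<and> t < (1::real)"
  show "norm (t *\<^sub>R x + (1 - t) *\<^sub>R y)
      \<le> max (norm x) (norm y) - 4 * c / M / 2 * t * (1 - t) * (norm (x - y))\<^sup>2"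
  proof (cases "norm y \<le> norm x")
    case True
    then show ?thesis
      using norm_convex_combination_le[of y x M t] M xy t by simp
  next
    case False
    then show ?thesis
      using norm_convex_combination_le[of x y M "1 - t"] M xy t
      by (simp add: add.commute norm_minus_commute mult_ac)
  qed
qed (use assms in auto)

end

theorem theorem3p6:
  fixes \<sigma> :: real
  assumes "uniformly_convex TYPE('a::banach)"
    and "dim_at_least_two TYPE('a)"
    and "\<sigma> > 0"
    and "\<forall>\<epsilon>\<in>{0..2}. modulus_of_convexity TYPE('a) \<epsilon> \<ge> \<sigma> / 8 * \<epsilon>\<^sup>2"
  shows "(\<forall>\<Omega> :: 'a set. \<Omega> \<noteq> {} \<and> bounded \<Omega> \<and> convex \<Omega> \<longrightarrow>
            (\<exists>\<sigma>\<^sub>\<Omega>>0. strongly_quasiconvex_on \<sigma>\<^sub>\<Omega> \<Omega> norm))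
       \<and> strongly_quasiconvex_on (\<sigma> / 2) (cball (0::'a) 1) norm"
proof -
  have *: "strongly_quasiconvex_on (\<sigma> / 2 / M) \<Omega> norm"
    if "M > 0" "\<Omega> \<noteq> {}" "convex \<Omega>" "\<And>x. x \<in> \<Omega> \<Longrightarrow> norm x \<le> M" for M and \<Omega> :: "'a set"
  proof -
    \<comment> \<open>The modulus bound supplies the midpoint inequality with
      \<open>c = \<sigma> / 8\<close>.\<close>
    have "strongly_quasiconvex_on (4 * (\<sigma> / 8) / M) \<Omega> norm"
      using assms(3) that norm_midpoint_le_of_modulus[OF assms(4)]
      by (intro strongly_quasiconvex_on_norm) auto
    then show ?thesis by simp
  qed
  show ?thesis
  proof (intro conjI allI impI)
    fix \<Omega> :: "'a set"
    assume \<Omega>: "\<Omega> \<noteq> {} \<and> bounded \<Omega> \<and> convex \<Omega>"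
    then obtain M where "M > 0" "\<And>x. x \<in> \<Omega> \<Longrightarrow> norm x \<le> M"
      by (metis bounded_pos)
    with \<Omega> * assms(3) show "\<exists>\<sigma>\<^sub>\<Omega>>0. strongly_quasiconvex_on \<sigma>\<^sub>\<Omega> \<Omega> norm"
      by (intro exI[of _ "\<sigma> / 2 / M"]) auto
  next
    show "strongly_quasiconvex_on (\<sigma> / 2) (cball (0::'a) 1) norm"
      using *[of 1 "cball 0 1"] by simp
  qed
qed

end
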